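(* Let $\mathcal{G}$ be a locally compact Hausdorff topological group, and let $P_{\aleph_0}(\mathcal{G})$ denote the class of all regular probability measures on $\mathcal{G}$ whose support is countable and contains the identity $e$. Let $\mu \in P_{\aleph_0}(\mathcal{G})$. If $\mu^{\dagger}$ is a Moore-Penrose inverse of $\mu$, then the support $S(\mu^{\dagger})$ is a finite subgroup of $\mathcal{G}$.
   Context: $P(\mathcal{G})$ is the semigroup of all regular Borel probability measures on $\mathcal{G}$ under convolution $(\mu\star\nu)(A) = \int_{\mathcal{G}} \mu(Ax^{-1})\,d\nu(x)$ for Borel sets $A$. $S(\mu)$ denotes the support of $\mu$. A Moore-Penrose inverse of $\mu\in P(\mathcal{G})$ is an element $\mu^{\dagger}\in P(\mathcal{G})$ with $\mu\star\mu^{\dagger}\star\mu=\mu$ and $\mu^{\dagger}\star\mu\star\mu^{\dagger}=\mu^{\dagger}$. Elements of $\mathcal{G}$ are not assumed to have finite order. *)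

theory Defs
  imports "HOL-Probability.Probability_Measure"
begin

text \<open>
  Topological groups are rendered by the library class \<open>topological_group_add\<close>. Its group
  operation is written additively but is \<^emph>\<open>not\<close> assumed to be commutative: \<open>x + y\<close> stands for the
  product $xy$, \<open>0\<close> for the identity $e$, \<open>- x\<close> for $x^{-1}$ and \<open>a - x\<close> for $a x^{-1}$.
\<close>

definition regular_prob_measures :: "'a::t2_space measure set" where
  "regular_prob_measures =
    {M. sets M = sets borel \<and> prob_space M \<and>
        (\<forall>A\<in>sets borel. emeasure M A = (SUP K\<in>{K. compact K \<and> K \<subseteq> A}. emeasure M K)) \<and>
        (\<forall>A\<in>sets borel. emeasure M A = (INF U\<in>{U. open U \<and> A \<subseteq> U}. emeasure M U))}"

definition measure_support :: "'a::topological_space measure \<Rightarrow> 'a set" where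
  "measure_support M = {x. \<forall>U. open U \<longrightarrow> x \<in> U \<longrightarrow> emeasure M U \<noteq> 0}"

text \<open>
  The set \<open>(\<lambda>a. a - x) ` A\<close> is $A x^{-1}$. The convolution is not taken from
  \<open>HOL-Probability.Convolution\<close>: that one pushes the product measure forward along the group
  operation, and without second countability this operation need not be measurable for the
  product of the Borel sigma-algebras.
\<close>

definition group_convolution ::
    "'a::topological_group_add measure \<Rightarrow> 'a measure \<Rightarrow> 'a measure" where
  "group_convolution M N =
    measure_of UNIV (sets borel) (\<lambda>A. \<integral>\<^sup>+ x. emeasure M ((\<lambda>a. a - x) ` A) \<partial>N)"

definition moore_penrose_inverse ::
    "'a::{topological_group_add, t2_space} measure \<Rightarrow> 'a measure \<Rightarrow> bool" where
  "moore_penrose_inverse M N \<longleftrightarrow>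
    N \<in> regular_prob_measures \<and>
    group_convolution (group_convolution M N) M = M \<and>
    group_convolution (group_convolution N M) N = N"

definition countable_support_prob_measures ::
    "'a::{topological_group_add, t2_space} measure set" where
  "countable_support_prob_measures =
    {M \<in> regular_prob_measures. countable (measure_support M) \<and> 0 \<in> measure_support M}"

definition is_subgroup :: "'a::group_add set \<Rightarrow> bool" where
  "is_subgroup H \<longleftrightarrow>
    0 \<in> H \<and> (\<forall>x\<in>H. \<forall>y\<in>H. x + y \<in> H) \<and> (\<forall>x\<in>H. - x \<in> H)"

end

theory Submission
  imports Defs "HOL-Probability.Probability_Mass_Function"
begin

text \<open>
  Write \<open>S\<close> and \<open>T\<close> for the supports of \<open>\<mu>\<close> and \<open>\<mu>'\<close>. The proof replaces both measures by probability
  mass functions and then works with their sets of atoms.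

  By inner regularity \<open>\<mu>\<close> lives on its countable support (\<open>null_outside_support\<close>), so it is a sum of
  point masses. The equation \<open>\<mu> \<star> \<mu>' \<star> \<mu> = \<mu>\<close> passes this on to \<open>\<mu>'\<close>: if \<open>A\<close> is the set of atoms of
  \<open>\<mu>\<close> and \<open>r\<close> is one of them, then \<open>r + x + r\<close> lies in \<open>A\<close> for \<open>\<mu>'\<close>-almost every \<open>x\<close>, so \<open>\<mu>'\<close> is carried by
  the countable set \<open>- r + A - r\<close> (\<open>countable_concentration_of_inner_inverse\<close>). On discrete measures the
  convolution is that of mass functions (\<open>group_convolution_borel_of_pmf\<close>), which is associative.

  For mass functions \<open>p\<close> and \<open>q\<close> with \<open>p q p = p\<close> and \<open>q p q = q\<close>, both \<open>p q\<close> and \<open>q p\<close> are idempotent.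
  By a maximum principle the set of atoms of an idempotent mass function is a finite subgroup
  (\<open>idempotent_pmf_finite_subgroup\<close>). This makes the sets of atoms of \<open>p\<close> and \<open>q\<close> finite, hence closed,
  hence equal to \<open>S\<close> and \<open>T\<close>. In particular the identity is an atom of \<open>p\<close>, which gives \<open>T \<subseteq> K\<close> for the
  finite subgroup \<open>K = T + S\<close>. As \<open>q p q = q\<close> also gives \<open>K + T = T\<close>, the nonempty set \<open>T\<close> is a union of
  cosets of \<open>K\<close> contained in \<open>K\<close>, so \<open>T = K\<close>.
\<close>

section \<open>Convolution of probability mass functions\<close>

definition conv_pmf :: "'a::group_add pmf \<Rightarrow> 'a pmf \<Rightarrow> 'a pmf" where
  "conv_pmf p q = bind_pmf q (\<lambda>y. map_pmf (\<lambda>x. x + y) p)"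

lemma set_conv_pmf: "set_pmf (conv_pmf p q) = {x + y | x y. x \<in> set_pmf p \<and> y \<in> set_pmf q}"
  by (auto simp: conv_pmf_def)

lemma conv_pmf_assoc: "conv_pmf (conv_pmf p q) r = conv_pmf p (conv_pmf q r)"
  by (simp add: conv_pmf_def map_bind_pmf bind_assoc_pmf bind_map_pmf pmf.map_comp o_def add.assoc)

lemma pmf_conv_pmf: "pmf (conv_pmf p q) z = (\<integral>y. pmf p (z - y) \<partial>measure_pmf q)"
proof -
  have "pmf (map_pmf (\<lambda>x. x + y) p) z = pmf p (z - y)" for y
    using pmf_map_inj'[of "\<lambda>x. x + y" p "z - y"] by (simp add: inj_on_def)
  then show ?thesis by (simp add: conv_pmf_def pmf_bind)
qed

lemma finite_pmf_ge:
  assumes "c > 0" shows "finite {x. pmf p x \<ge> c}"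
proof (rule finite_if_finite_subsets_card_bdd[THEN conjunct1])
  fix F assume F: "F \<subseteq> {x. pmf p x \<ge> c}" "finite F"
  have "real (card F) * c \<le> (\<Sum>x\<in>F. pmf p x)"
    using F by (intro sum_bounded_below) auto
  also have "\<dots> = measure (measure_pmf p) F"
    using F(2) by (simp add: measure_measure_pmf_finite)
  also have "\<dots> \<le> 1" by simp
  finally have "real (card F) \<le> 1 / c"
    using assms by (simp add: field_simps)
  then show "card F \<le> nat \<lfloor>1 / c\<rfloor>" by (simp add: le_nat_floor)
qed

lemma pmf_attains_max: obtains x where "\<And>y. pmf p y \<le> pmf p x"
proof -
  obtain x0 where x0: "x0 \<in> set_pmf p" using set_pmf_not_empty[of p] by blast
  define B where "B = {x. pmf p x \<ge> pmf p x0}"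
  have fin: "finite B" unfolding B_def by (rule finite_pmf_ge) (use x0 in \<open>simp add: pmf_positive\<close>)
  have "x0 \<in> B" by (simp add: B_def)
  then have "Max (pmf p ` B) \<in> pmf p ` B" using fin by (intro Max_in) auto
  then obtain x where x: "x \<in> B" "pmf p x = Max (pmf p ` B)" by auto
  have "pmf p y \<le> pmf p x" for y
  proof (cases "y \<in> B")
    case True then show ?thesis using fin x(2) by simp
  next
    case False then show ?thesis using x(1) by (simp add: B_def)
  qed
  then show thesis by (rule that)
qed

lemma is_subgroup_if_diff_closed:
  assumes "H \<noteq> {}" and diff: "\<And>x y. x \<in> H \<Longrightarrow> y \<in> H \<Longrightarrow> x - y \<in> H"
  shows "is_subgroup H"
proof -
  have zero: "0 \<in> H" using assms diff by (metis all_not_in_conv diff_self)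
  then have minus: "- x \<in> H" if "x \<in> H" for x using diff[OF zero that] by simp
  have "x + y \<in> H" if "x \<in> H" "y \<in> H" for x y
    using diff[OF that(1) minus[OF that(2)]] by simp
  with zero minus show ?thesis by (simp add: is_subgroup_def)
qed

text \<open>
  The equation \<open>f = f \<star> f\<close> says that \<open>f x\<close> is the \<open>f\<close>-average of the values \<open>f (x - y)\<close>. At a maximum
  point \<open>x\<close> no value in the average can be smaller, so the set \<open>D\<close> of maximum points is mapped into
  itself by subtracting any atom \<open>y\<close>. Since \<open>D\<close> is finite, the orbit map \<open>y \<mapsto> m - y\<close> injects the
  atoms into \<open>D\<close>, and \<open>D\<close> consists of atoms, so the two sets agree and are closed under differences.
\<close>

lemma idempotent_pmf_finite_subgroup:
  assumes idem: "conv_pmf f f = f"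
  shows "finite (set_pmf f)" and "is_subgroup (set_pmf f)"
proof -
  obtain m where m: "\<And>y. pmf f y \<le> pmf f m" using pmf_attains_max[of f] by metis
  define D where "D = {x. pmf f x = pmf f m}"
  have "m \<in> D" by (simp add: D_def)
  obtain x0 where "x0 \<in> set_pmf f" using set_pmf_not_empty[of f] by blast
  then have pos: "pmf f m > 0" using m[of x0] pmf_positive[of x0 f] by linarith
  have DE: "D \<subseteq> set_pmf f" using pos by (auto simp: D_def set_pmf_iff)
  have "finite D" using finite_pmf_ge[OF pos, of f] by (rule finite_subset[rotated]) (auto simp: D_def)
  have diffD: "x - y \<in> D" if "x \<in> D" "y \<in> set_pmf f" for x y
  proof -
    have int: "integrable (measure_pmf f) (\<lambda>y. pmf f (x - y))"
      by (rule measure_pmf.integrable_const_bound[where B=1]) (auto simp: pmf_le_1)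
    have "(\<integral>y. pmf f m - pmf f (x - y) \<partial>measure_pmf f) = pmf f m - pmf (conv_pmf f f) x"
      using int by (simp add: pmf_conv_pmf)
    also have "\<dots> = 0" using that(1) by (simp add: idem D_def)
    finally have "AE y in measure_pmf f. pmf f m - pmf f (x - y) = 0"
      using int m by (subst (asm) integral_nonneg_eq_0_iff_AE) auto
    then show ?thesis using that(2) by (auto simp: AE_measure_pmf_iff D_def)
  qed
  have inj: "inj_on (\<lambda>y. m - y) (set_pmf f)" by (rule inj_onI) (metis diff_conv_add_uminus add_left_cancel neg_equal_iff_equal)
  have im: "(\<lambda>y. m - y) ` set_pmf f \<subseteq> D" using diffD \<open>m \<in> D\<close> by auto
  show fin: "finite (set_pmf f)" using inj im \<open>finite D\<close> by (rule inj_on_finite)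
  have "card (set_pmf f) \<le> card D" using inj im \<open>finite D\<close> by (rule card_inj_on_le)
  then have "D = set_pmf f" using card_seteq[OF fin DE] by simp
  then show "is_subgroup (set_pmf f)"
    using diffD by (intro is_subgroup_if_diff_closed) (auto simp: set_pmf_not_empty)
qed

text \<open>
  The finiteness of the two factors comes from the subgroup of atoms of \<open>p \<star> q\<close>, which contains
  a translate of each of them. Once \<open>0\<close> is an atom of \<open>p\<close>, the atoms of \<open>q\<close> lie in the subgroup of atoms
  of \<open>q \<star> p\<close> and are stable under its left translations.
\<close>

lemma moore_penrose_pmf_subgroup:
  assumes pqp: "conv_pmf (conv_pmf p q) p = p" and qpq: "conv_pmf (conv_pmf q p) q = q"
  shows "finite (set_pmf p)"
    and "finite (set_pmf q)"
    and "0 \<in> set_pmf p \<Longrightarrow> is_subgroup (set_pmf q)"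
proof -
  let ?A = "set_pmf p" and ?T = "set_pmf q"
  let ?H = "set_pmf (conv_pmf p q)" and ?K = "set_pmf (conv_pmf q p)"
  have "conv_pmf (conv_pmf p q) (conv_pmf p q) = conv_pmf p q"
    using pqp by (simp add: conv_pmf_assoc[symmetric])
  note H = idempotent_pmf_finite_subgroup[OF this]
  have "conv_pmf (conv_pmf q p) (conv_pmf q p) = conv_pmf q p"
    using qpq by (simp add: conv_pmf_assoc[symmetric])
  note K = idempotent_pmf_finite_subgroup[OF this]
  have AT: "a + t \<in> ?H" if "a \<in> ?A" "t \<in> ?T" for a t using that by (auto simp: set_conv_pmf)
  have TA: "t + a \<in> ?K" if "a \<in> ?A" "t \<in> ?T" for a t using that by (auto simp: set_conv_pmf)
  have KT: "k + t \<in> ?T" if "k \<in> ?K" "t \<in> ?T" for k t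
    using that set_conv_pmf[of "conv_pmf q p" q] unfolding qpq by blast
  obtain a0 where a0: "a0 \<in> ?A" using set_pmf_not_empty[of p] by blast
  obtain t0 where t0: "t0 \<in> ?T" using set_pmf_not_empty[of q] by blast
  show "finite ?A"
    by (rule inj_on_finite[of "\<lambda>a. a + t0" _ ?H]) (use AT t0 H(1) in \<open>auto simp: inj_on_def\<close>)
  show "finite ?T"
    by (rule inj_on_finite[of "\<lambda>t. a0 + t" _ ?H]) (use AT a0 H(1) in \<open>auto simp: inj_on_def\<close>)
  assume zero: "0 \<in> ?A"
  have TK: "?T \<subseteq> ?K" using TA[OF zero] by auto
  have "?K \<subseteq> ?T"
  proof
    fix k assume k: "k \<in> ?K"
    have "- t0 \<in> ?K" using K(2) TK t0 by (auto simp: is_subgroup_def)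
    then have "k + - t0 \<in> ?K" using K(2) k unfolding is_subgroup_def by blast
    from KT[OF this t0] show "k \<in> ?T" by (simp add: add.assoc)
  qed
  with TK K(2) show "is_subgroup ?T" by simp
qed

section \<open>Discrete Borel measures\<close>

definition borel_of_pmf :: "'a::topological_space pmf \<Rightarrow> 'a measure" where
  "borel_of_pmf p = distr (measure_pmf p) borel (\<lambda>x. x)"

lemma sets_borel_of_pmf [simp]: "sets (borel_of_pmf p) = sets borel"
  and space_borel_of_pmf [simp]: "space (borel_of_pmf p) = UNIV"
  by (simp_all add: borel_of_pmf_def)

lemma emeasure_borel_of_pmf:
  "B \<in> sets borel \<Longrightarrow> emeasure (borel_of_pmf p) B = emeasure (measure_pmf p) B"
  by (simp add: borel_of_pmf_def emeasure_distr)

lemma inj_borel_of_pmf: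
  fixes p q :: "'a::t1_space pmf"
  assumes "borel_of_pmf p = borel_of_pmf q" shows "p = q"
proof (rule pmf_eqI)
  fix x
  have "emeasure (borel_of_pmf p) {x} = emeasure (borel_of_pmf q) {x}" using assms by simp
  then show "pmf p x = pmf q x" by (simp add: emeasure_borel_of_pmf emeasure_pmf_single)
qed

text \<open>
  The convolution formula integrates functions whose Borel measurability is not evident. Cutting such
  a function off outside the countable set of atoms changes it only on a null set, and the result is
  Borel because it vanishes off a countable set.
\<close>

lemma nn_integral_borel_of_pmf:
  fixes p :: "'a::t1_space pmf"
  shows "(\<integral>\<^sup>+x. g x \<partial>borel_of_pmf p) = (\<integral>\<^sup>+x. g x \<partial>measure_pmf p)"
proof -
  let ?g = "\<lambda>x. g x * indicator (set_pmf p) x"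
  have meas: "?g \<in> borel_measurable borel"
    by (rule measurable_discrete_difference[where f = "\<lambda>_. 0" and X = "set_pmf p"])
       (auto simp: countable_set_pmf)
  have C: "set_pmf p \<in> sets borel"
    by (rule sets.countable) (auto simp: countable_set_pmf)
  have "AE x in borel_of_pmf p. x \<in> set_pmf p"
    unfolding borel_of_pmf_def using C by (subst AE_distr_iff) (auto simp: AE_measure_pmf_iff)
  then have "(\<integral>\<^sup>+x. g x \<partial>borel_of_pmf p) = (\<integral>\<^sup>+x. ?g x \<partial>borel_of_pmf p)"
    by (intro nn_integral_cong_AE) auto
  also have "\<dots> = (\<integral>\<^sup>+x. ?g x \<partial>measure_pmf p)"
    unfolding borel_of_pmf_def using meas by (subst nn_integral_distr) auto
  also have "\<dots> = (\<integral>\<^sup>+x. g x \<partial>measure_pmf p)"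
    by (intro nn_integral_cong_AE) (auto simp: AE_measure_pmf_iff)
  finally show ?thesis .
qed

lemma borel_of_pmf_if_countable:
  fixes M :: "'a::t1_space measure"
  assumes "prob_space M" and sets: "sets M = sets borel"
    and C: "countable C" and null: "emeasure M (- C) = 0"
  obtains p where "M = borel_of_pmf p"
proof -
  interpret prob_space M by fact
  have single: "{x} \<in> sets M" for x by (simp add: sets)
  have cnt: "X \<in> sets M" if "countable X" for X
    using single that by (rule sets.countable)
  have space: "space M = UNIV" using sets_eq_imp_space_eq[OF sets] by simp
  have C_compl: "- C \<in> sets M" using sets.compl_sets[OF cnt[OF C]] by (simp add: space Compl_eq_Diff_UNIV)
  have restrict: "emeasure M B = emeasure M (B \<inter> C)" if "B \<in> sets M" for B
  proof -
    have "AE x in M. x \<in> C" using null C_compl by (intro AE_I[of _ _ "- C"]) (auto simp: space)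
    then show ?thesis using that cnt[OF C] by (intro emeasure_eq_AE) auto
  qed
  have conc: "emeasure M B = (\<integral>\<^sup>+x. emeasure M {x} \<partial>count_space (B \<inter> C))" if "B \<in> sets M" for B
    unfolding restrict[OF that] using C single by (intro emeasure_countable_singleton) auto
  have zero: "prob {x} = 0" if "x \<notin> C" for x
    using null C_compl that emeasure_mono[of "{x}" "- C" M] by (auto simp: emeasure_eq_measure)
  define p where "p = embed_pmf (\<lambda>x. prob {x})"
  have "(\<integral>\<^sup>+x. ennreal (prob {x}) \<partial>count_space UNIV) = (\<integral>\<^sup>+x. ennreal (prob {x}) \<partial>count_space C)"
    using zero by (subst nn_integral_count_space_indicator)
      (auto intro!: nn_integral_cong simp: nn_integral_count_space_indicator indicator_def)
  also have "\<dots> = emeasure M UNIV"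
    using conc[of UNIV] sets.top[of M] by (simp add: space emeasure_eq_measure)
  also have "\<dots> = 1" using emeasure_space_1 by (simp add: space)
  finally have pmf_p: "pmf p x = prob {x}" for x
    unfolding p_def by (subst pmf_embed_pmf) auto
  have setp: "set_pmf p \<subseteq> C"
  proof
    fix x assume "x \<in> set_pmf p"
    then show "x \<in> C" using zero[of x] by (simp add: set_pmf_iff pmf_p) metis
  qed
  have "M = borel_of_pmf p"
  proof (rule measure_eqI)
    fix B assume B: "B \<in> sets M"
    have "emeasure M B = (\<integral>\<^sup>+x. emeasure (measure_pmf p) {x} \<partial>count_space (B \<inter> C))"
      unfolding conc[OF B] by (simp add: emeasure_pmf_single pmf_p emeasure_eq_measure)
    also have "\<dots> = emeasure (measure_pmf p) (B \<inter> C)"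
      using C by (intro emeasure_countable_singleton[symmetric]) auto
    also have "\<dots> = emeasure (measure_pmf p) B"
      using setp by (intro emeasure_eq_AE) (auto simp: AE_measure_pmf_iff)
    also have "\<dots> = emeasure (borel_of_pmf p) B" using B by (simp add: sets emeasure_borel_of_pmf)
    finally show "emeasure M B = emeasure (borel_of_pmf p) B" .
  qed (simp add: sets)
  then show thesis by (rule that)
qed

lemma measure_support_borel_of_finite_pmf:
  fixes p :: "'a::t1_space pmf"
  assumes "finite (set_pmf p)"
  shows "measure_support (borel_of_pmf p) = set_pmf p"
proof (intro set_eqI iffI)
  fix x assume x: "x \<in> measure_support (borel_of_pmf p)"
  have op: "open (- set_pmf p)" using finite_imp_closed[OF assms] by (simp add: open_Compl)
  have "emeasure (borel_of_pmf p) (- set_pmf p) = 0"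
    using op by (subst emeasure_borel_of_pmf) (auto simp: measure_pmf.emeasure_eq_measure measure_pmf_zero_iff)
  then show "x \<in> set_pmf p" using x op by (auto simp: measure_support_def)
next
  fix x assume "x \<in> set_pmf p"
  then show "x \<in> measure_support (borel_of_pmf p)"
    by (auto simp: measure_support_def emeasure_borel_of_pmf measure_pmf.emeasure_eq_measure measure_pmf_zero_iff)
qed

text \<open>
  The complement of the support is a union of open null sets, possibly uncountably many. Finitely many
  of them cover any compact subset, and inner regularity reduces the claim to compact subsets.
\<close>

lemma null_outside_support:
  assumes "M \<in> regular_prob_measures"
  shows "emeasure M (- measure_support M) = 0"
proof -
  let ?S = "measure_support M"
  have sets: "sets M = sets borel" using assms by (simp add: regular_prob_measures_def)
  define N where "N = {U. open U \<and> emeasure M U = 0}"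
  have S: "- ?S = \<Union> N" by (auto simp: measure_support_def N_def)
  have "open (\<Union> N)" by (auto simp: N_def)
  then have "emeasure M (\<Union> N) = (SUP K\<in>{K. compact K \<and> K \<subseteq> \<Union> N}. emeasure M K)"
    using assms by (simp add: regular_prob_measures_def)
  also have "\<dots> \<le> 0"
  proof (rule SUP_least)
    fix K assume "K \<in> {K. compact K \<and> K \<subseteq> \<Union> N}"
    then have K: "compact K" "K \<subseteq> \<Union> N" by simp_all
    have "open U" if "U \<in> N" for U using that by (simp add: N_def)
    from compactE[OF K this] obtain F where F: "F \<subseteq> N" "finite F" "K \<subseteq> \<Union> F"
      by metis
    have "U \<in> null_sets M" if "U \<in> F" for U
      using F(1) that by (auto simp: N_def null_sets_def sets)
    then have "\<Union> F \<in> null_sets M"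
      using null_sets_UN'[of F "\<lambda>U. U" M] F(2) by (simp add: countable_finite)
    then show "emeasure M K \<le> 0" using emeasure_mono[OF F(3), of M] by (auto simp: null_sets_def)
  qed
  finally show ?thesis by (simp add: S)
qed

section \<open>Convolution of Borel measures\<close>

lemma image_diff_eq_vimage: "(\<lambda>a. a - x) ` A = (\<lambda>a. a + x) -` A" for x :: "'a::group_add"
  by (auto simp: image_iff) (metis add_diff_cancel)

lemma right_translate_borel:
  fixes A :: "'a::topological_group_add set"
  assumes "A \<in> sets borel" shows "(\<lambda>a. a + x) -` A \<in> sets borel"
proof -
  have "(\<lambda>a. a + x) \<in> borel_measurable borel"
    by (intro borel_measurable_continuous_onI continuous_intros)
  from measurable_sets[OF this assms] show ?thesis by simp
qed

lemma group_convolution_borel_of_pmf: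
  fixes p q :: "'a::{topological_group_add, t1_space} pmf"
  shows "group_convolution (borel_of_pmf p) (borel_of_pmf q) = borel_of_pmf (conv_pmf p q)"
proof -
  have "(\<integral>\<^sup>+x. emeasure (borel_of_pmf p) ((\<lambda>a. a - x) ` A) \<partial>borel_of_pmf q)
      = emeasure (borel_of_pmf (conv_pmf p q)) A" if A: "A \<in> sets borel" for A
    using right_translate_borel[OF A]
    by (simp add: nn_integral_borel_of_pmf image_diff_eq_vimage emeasure_borel_of_pmf A
        conv_pmf_def emeasure_bind_pmf)
  then have "group_convolution (borel_of_pmf p) (borel_of_pmf q)
      = measure_of UNIV (sets borel) (emeasure (borel_of_pmf (conv_pmf p q)))"
    unfolding group_convolution_def
    by (intro measure_of_eq) (auto simp: sets.sigma_sets_eq[of borel, simplified])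
  also have "\<dots> = borel_of_pmf (conv_pmf p q)"
    using measure_of_of_measure[of "borel_of_pmf (conv_pmf p q)"] by simp
  finally show ?thesis .
qed

text \<open>
  If the set function in the definition of the convolution is not countably additive, then
  \<open>measure_of\<close> yields the null measure. A convolution that is not null is therefore given by its
  formula, so that for the equations of a Moore-Penrose inverse additivity comes for free.
\<close>

lemma emeasure_group_convolution:
  assumes "emeasure (group_convolution M N) UNIV \<noteq> 0" and A: "A \<in> sets borel"
  shows "emeasure (group_convolution M N) A = (\<integral>\<^sup>+x. emeasure M ((\<lambda>a. a + x) -` A) \<partial>N)"
proof -
  let ?f = "\<lambda>A. \<integral>\<^sup>+x. emeasure M ((\<lambda>a. a + x) -` A) \<partial>N"
  have eq: "emeasure (group_convolution M N) B
      = (if B \<in> sigma_sets UNIV (sets borel) \<and> measure_space UNIV (sigma_sets UNIV (sets borel)) ?f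
         then ?f B else 0)" for B
    unfolding group_convolution_def by (simp add: emeasure_measure_of_conv image_diff_eq_vimage)
  have "measure_space UNIV (sigma_sets UNIV (sets borel)) ?f"
    using assms(1) unfolding eq by (auto split: if_splits)
  then show ?thesis unfolding eq using A by (auto intro: sigma_sets.Basic)
qed

lemma emeasure_group_convolution_null:
  assumes "emeasure M UNIV = 0"
  shows "emeasure (group_convolution M N) UNIV = 0"
  using emeasure_group_convolution[of M N UNIV] assms by auto

text \<open>
  The set \<open>- A\<close> of non-atoms is null for the threefold convolution. Keeping only the contribution of
  a single atom \<open>r\<close> on either side shows that the points \<open>x\<close> with \<open>r + x + r \<notin> A\<close> are null for \<open>N\<close>.
\<close>

lemma countable_concentration_of_inner_inverse:
  fixes N :: "'a::{topological_group_add, t1_space} measure"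
  assumes sets: "sets N = sets borel"
    and eq: "group_convolution (group_convolution (borel_of_pmf p) N) (borel_of_pmf p) = borel_of_pmf p"
  obtains C where "countable C" and "emeasure N (- C) = 0"
proof -
  let ?A = "set_pmf p" and ?R = "group_convolution (borel_of_pmf p) N"
  have tot: "emeasure (borel_of_pmf p) UNIV = 1"
    by (simp add: emeasure_borel_of_pmf measure_pmf.emeasure_space_1[simplified])
  have R: "emeasure ?R UNIV \<noteq> 0"
    using emeasure_group_convolution_null[of ?R "borel_of_pmf p"] by (auto simp: eq tot)
  obtain r where r: "r \<in> ?A" using set_pmf_not_empty[of p] by blast
  have A: "- ?A \<in> sets borel"
    using sets.countable[of ?A borel] by (auto simp: countable_set_pmf borel_comp)
  let ?B = "(\<lambda>a. a + r) -` (- ?A)"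
  have B: "?B \<in> sets borel" by (rule right_translate_borel[OF A])
  have "0 = emeasure (borel_of_pmf p) (- ?A)"
    using A by (simp add: emeasure_borel_of_pmf measure_pmf.emeasure_eq_measure measure_pmf_zero_iff)
  also have "\<dots> = (\<integral>\<^sup>+x. emeasure ?R ((\<lambda>a. a + x) -` (- ?A)) \<partial>measure_pmf p)"
    using emeasure_group_convolution[of ?R "borel_of_pmf p", OF _ A]
    by (simp add: eq tot nn_integral_borel_of_pmf)
  finally have "AE x in measure_pmf p. emeasure ?R ((\<lambda>a. a + x) -` (- ?A)) = 0"
    by (subst (asm) eq_commute) (simp add: nn_integral_0_iff_AE)
  then have "emeasure ?R ?B = 0" using r by (auto simp: AE_measure_pmf_iff)
  then have int0: "(\<integral>\<^sup>+x. emeasure (borel_of_pmf p) ((\<lambda>a. a + x) -` ?B) \<partial>N) = 0"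
    using emeasure_group_convolution[OF R B] by simp
  \<comment> \<open>The solutions \<open>x\<close> of \<open>r + x + r \<in> A\<close>.\<close>
  define C where "C = (\<lambda>a. - r + a - r) ` ?A"
  have C: "countable C" by (simp add: C_def countable_set_pmf)
  then have CB: "- C \<in> sets N"
    using sets.countable[of C borel] by (auto simp: sets borel_comp)
  have low: "ennreal (pmf p r) * indicator (- C) x \<le> emeasure (borel_of_pmf p) ((\<lambda>a. a + x) -` ?B)" for x
  proof (cases "x \<in> C")
    case False
    have "r + x + r \<notin> ?A"
    proof
      assume "r + x + r \<in> ?A"
      moreover have "x = - r + (r + x + r) - r" by (simp add: add.assoc[symmetric])
      ultimately show False using False unfolding C_def by blast
    qed
    then have "{r} \<subseteq> (\<lambda>a. a + x) -` ?B" by auto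
    then have "emeasure (measure_pmf p) {r} \<le> emeasure (measure_pmf p) ((\<lambda>a. a + x) -` ?B)"
      by (intro emeasure_mono) auto
    then show ?thesis using False right_translate_borel[OF B, of x]
      by (simp add: emeasure_borel_of_pmf emeasure_pmf_single)
  qed simp
  have "ennreal (pmf p r) * emeasure N (- C) = (\<integral>\<^sup>+x. ennreal (pmf p r) * indicator (- C) x \<partial>N)"
    using CB by (simp add: nn_integral_cmult_indicator)
  also have "\<dots> \<le> 0" unfolding int0[symmetric] by (rule nn_integral_mono) (rule low)
  finally have "emeasure N (- C) = 0" using r by (auto simp: set_pmf_iff)
  with C show thesis by (rule that)
qed

theorem theorem4p3:
  fixes \<mu> \<mu>' :: "'a::{topological_group_add, t2_space} measure"
  assumes "locally_compact_space (euclidean :: 'a topology)"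
    and "\<mu> \<in> countable_support_prob_measures"
    and "moore_penrose_inverse \<mu> \<mu>'"
  shows "finite (measure_support \<mu>') \<and> is_subgroup (measure_support \<mu>')"
proof -
  have \<mu>: "\<mu> \<in> regular_prob_measures" "countable (measure_support \<mu>)" "0 \<in> measure_support \<mu>"
    using assms(2) by (auto simp: countable_support_prob_measures_def)
  have \<mu>': "\<mu>' \<in> regular_prob_measures"
    and eq1: "group_convolution (group_convolution \<mu> \<mu>') \<mu> = \<mu>"
    and eq2: "group_convolution (group_convolution \<mu>' \<mu>) \<mu>' = \<mu>'"
    using assms(3) by (auto simp: moore_penrose_inverse_def)
  obtain p where p: "\<mu> = borel_of_pmf p"
    using borel_of_pmf_if_countable[of \<mu> "measure_support \<mu>"] \<mu> null_outside_support[OF \<mu>(1)]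
    by (auto simp: regular_prob_measures_def)
  obtain C where "countable C" "emeasure \<mu>' (- C) = 0"
    using countable_concentration_of_inner_inverse[of \<mu>' p] eq1 \<mu>' unfolding p
    by (auto simp: regular_prob_measures_def)
  then obtain q where q: "\<mu>' = borel_of_pmf q"
    using borel_of_pmf_if_countable[of \<mu>' C] \<mu>' by (auto simp: regular_prob_measures_def)
  have pqp: "conv_pmf (conv_pmf p q) p = p"
    using eq1 unfolding p q group_convolution_borel_of_pmf by (rule inj_borel_of_pmf)
  have qpq: "conv_pmf (conv_pmf q p) q = q"
    using eq2 unfolding p q group_convolution_borel_of_pmf by (rule inj_borel_of_pmf)
  note mp = moore_penrose_pmf_subgroup[OF pqp qpq]
  have "0 \<in> set_pmf p"
    using \<mu>(3) unfolding p measure_support_borel_of_finite_pmf[OF mp(1)] .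
  with mp show ?thesis unfolding q measure_support_borel_of_finite_pmf[OF mp(2)] by blast
qed

end
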